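(* Let $\mathscr{M}$ be a real separable Hilbert space with inner product $\langle\cdot,\cdot\rangle$, let $\mathcal{A}$ be a bounded selfadjoint linear operator on $\mathscr{M}$, and let $b\in\mathscr{M}$. Consider the quadratic functional $\mathcal{Z}:\mathscr{M}\to\mathbb{R}$ given by $$\mathcal{Z}(m) := \frac12\langle \mathcal{A}m,m\rangle + \langle b,m\rangle,\qquad m\in\mathscr{M}.$$ Let $\mu=\mathsf{N}(m_0,\mathcal{C})$ be a Gaussian measure on $\mathscr{M}$. Then $$\mathbb{V}_\mu\{\mathcal{Z}\} = \|\mathcal{A}m_0+b\|_{\mathcal{C}}^2+\frac12\,\mathrm{tr}\big((\mathcal{C}\mathcal{A})^2\big).$$
   Context: $\mathsf{N}(m_0,\mathcal{C})$ denotes the Gaussian measure on the real separable Hilbert space $\mathscr{M}$ with mean $m_0\in\mathscr{M}$ and covariance operator $\mathcal{C}$ (a positive selfadjoint trace-class operator), i.e. $\langle m_0,v\rangle=\int_{\mathscr{M}}\langle s,v\rangle\,\mu(ds)$ and $\langle\mathcal{C}u,v\rangle=\int_{\mathscr{M}}\langle u,s-m_0\rangle\langle v,s-m_0\rangle\,\mu(ds)$ for all $u,v\in\mathscr{M}$. The weighted norm is $\|x\|_{\mathcal{C}}^2:=\langle\mathcal{C}x,x\rangle$. $\mathbb{V}_\mu\{\mathcal{Z}\}=\int_{\mathscr{M}}\mathcal{Z}^2\,d\mu-\big(\int_{\mathscr{M}}\mathcal{Z}\,d\mu\big)^2$ is the variance of $\mathcal{Z}$ under $\mu$, and $\mathrm{tr}$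 is the trace of a trace-class operator. *)

theory Defs
  imports "HOL-Probability.Probability"
begin

text \<open>A real separable Hilbert space is a type of sort \<open>{real_inner, polish_space}\<close>:
  for metric spaces, second countability is the same as separability.\<close>

definition selfadjoint :: "('a::real_inner \<Rightarrow> 'a) \<Rightarrow> bool" where
  "selfadjoint T \<longleftrightarrow> (\<forall>x y. T x \<bullet> y = x \<bullet> T y)"

text \<open>Positivity is not assumed to be strict, so degenerate covariances are included.\<close>

definition positive_selfadjoint :: "('a::real_inner \<Rightarrow> 'a) \<Rightarrow> bool" where
  "positive_selfadjoint T \<longleftrightarrow> bounded_linear T \<and> selfadjoint T \<and> (\<forall>x. 0 \<le> T x \<bullet> x)"

definition orthonormal_basis :: "'a::real_inner set \<Rightarrow> bool" where
  "orthonormal_basis B \<longleftrightarrow>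
     pairwise orthogonal B \<and> (\<forall>e\<in>B. norm e = 1) \<and> closure (span B) = UNIV"

text \<open>Here \<open>P\<close> is the absolute value of \<open>T\<close>, the unique positive square root of \<open>T\<^sup>* T\<close>.
  For a positive operator, summability over one orthonormal basis is equivalent to
  summability over all of them.\<close>

definition trace_class :: "('a::{real_inner, complete_space} \<Rightarrow> 'a) \<Rightarrow> bool" where
  "trace_class T \<longleftrightarrow> bounded_linear T \<and>
     (\<exists>P B. positive_selfadjoint P \<and> P \<circ> P = adjoint T \<circ> T \<and>
            orthonormal_basis B \<and> (\<lambda>e. P e \<bullet> e) summable_on B)"

text \<open>The common value, over all orthonormal bases, of the sum of the diagonal entries
  (\<open>trace\<close> in HOL-Analysis is for matrices only).\<close>

definition op_trace :: "('a::{real_inner, complete_space} \<Rightarrow> 'a) \<Rightarrow> real" where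
  "op_trace T = (THE t. \<forall>B. orthonormal_basis B \<longrightarrow> ((\<lambda>e. T e \<bullet> e) has_sum t) B)"

text \<open>Point masses count as Gaussian, with standard deviation 0.\<close>

definition gaussian_real :: "real measure \<Rightarrow> bool" where
  "gaussian_real \<nu> \<longleftrightarrow>
     (\<exists>a. \<nu> = return borel a) \<or>
     (\<exists>a \<sigma>. \<sigma> > 0 \<and> \<nu> = density lborel (\<lambda>x. ennreal (normal_density a \<sigma> x)))"

definition gaussian_measure :: "'a::{real_inner, polish_space} measure \<Rightarrow> bool" where
  "gaussian_measure \<mu> \<longleftrightarrow> prob_space \<mu> \<and> sets \<mu> = sets borel \<and>
     (\<forall>f::'a \<Rightarrow> real. bounded_linear f \<longrightarrow> gaussian_real (distr \<mu> borel f))"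

text \<open>\<open>is_N m0 C \<mu>\<close> says that \<open>\<mu>\<close> is the Gaussian measure with mean \<open>m0\<close> and
  covariance operator \<open>C\<close>.\<close>

definition is_N ::
  "'a::{real_inner, polish_space} \<Rightarrow> ('a \<Rightarrow> 'a) \<Rightarrow> 'a measure \<Rightarrow> bool" where
  "is_N m0 C \<mu> \<longleftrightarrow> gaussian_measure \<mu> \<and> positive_selfadjoint C \<and> trace_class C \<and>
     (\<forall>v. m0 \<bullet> v = (\<integral>s. s \<bullet> v \<partial>\<mu>)) \<and>
     (\<forall>u v. C u \<bullet> v = (\<integral>s. (u \<bullet> (s - m0)) * (v \<bullet> (s - m0)) \<partial>\<mu>))"

definition weighted_norm :: "('a::real_inner \<Rightarrow> 'a) \<Rightarrow> 'a \<Rightarrow> real" where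
  "weighted_norm C x = sqrt (C x \<bullet> x)"

definition Var :: "'a measure \<Rightarrow> ('a \<Rightarrow> real) \<Rightarrow> real" where
  "Var \<mu> Z = (\<integral>s. (Z s)\<^sup>2 \<partial>\<mu>) - (\<integral>s. Z s \<partial>\<mu>)\<^sup>2"

definition quadratic_functional :: "('a::real_inner \<Rightarrow> 'a) \<Rightarrow> 'a \<Rightarrow> 'a \<Rightarrow> real" where
  "quadratic_functional A b m = 1/2 * (A m \<bullet> m) + b \<bullet> m"

end

theory Submission
  imports Defs
begin

text \<open>Write \<open>X = s - m0\<close>. Since \<open>A\<close> is selfadjoint, the functional is
  \<open>k + \<langle>w, X\<rangle> + Q / 2\<close> with a constant \<open>k\<close>, \<open>w = A m0 + b\<close> and \<open>Q = \<langle>A X, X\<rangle>\<close>. The linear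
  part has variance \<open>\<langle>C w, w\<rangle>\<close>, and it is uncorrelated with \<open>Q\<close> because third moments of a
  centred Gaussian vanish. So the theorem amounts to \<open>Var Q = 2 tr ((C A)\<^sup>2)\<close>.

  In finite dimension this is Wick's formula for \<open>\<bbbE> (X\<^sub>a X\<^sub>b X\<^sub>c X\<^sub>d)\<close>
  (\<open>isserlis_fourth\<close>, obtained by polarising the fourth moment of a one-dimensional Gaussian).
  In the Hilbert space, the sums over coordinates have to be exchanged with the expectation. All
  these exchanges are instances of one fact, \<open>has_sum_expectation_form\<close>: for every orthonormal basis,
  \<open>\<bbbE> (\<langle>T X, X\<rangle> G) = \<Sum>\<^sub>e \<bbbE> (\<langle>e, X\<rangle> \<langle>T e, X\<rangle> G)\<close>,
  by dominated convergence along finite sets of basis vectors, with majorant \<open>\<parallel>T\<parallel> \<parallel>X\<parallel>\<^sup>2 \<bar>G\<bar>\<close>.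
  Taking \<open>G = 1\<close> identifies \<open>\<bbbE> \<langle>T X, X\<rangle>\<close> with the trace sum \<open>\<Sum>\<^sub>e \<langle>C e, T e\<rangle>\<close> in every basis, so
  that \<open>op_trace ((C \<circ> A) ^^ 2)\<close> is \<open>\<bbbE> \<langle>A C A X, X\<rangle>\<close> (\<open>op_trace_CA_square\<close>). Taking
  \<open>G = \<langle>u, X\<rangle> \<langle>v, X\<rangle>\<close> and then \<open>G = Q\<close> reduces \<open>\<bbbE> Q\<^sup>2\<close> to fourth moments of coordinates
  (\<open>expectation_form_square\<close>).

  The majorants need \<open>\<bbbE> \<parallel>X\<parallel>\<^sup>4 < \<infinity>\<close>, which follows by Fatou's lemma from
  \<open>\<Sum>\<^sub>e \<langle>C e, e\<rangle> < \<infinity>\<close>. The trace-class condition provides this sum for the absolute value of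
  \<open>C\<close>; the absolute value is \<open>C\<close> itself because positive square roots are unique
  (\<open>positive_square_root_unique\<close>).\<close>

section \<open>Orthonormal bases\<close>

lemma orthonormal_basis_inner:
  assumes "orthonormal_basis B" "e \<in> B" "f \<in> B"
  shows "e \<bullet> f = (if e = f then 1 else 0)"
proof (cases "e = f")
  case True
  then show ?thesis
    using assms by (simp add: orthonormal_basis_def power2_norm_eq_inner[symmetric])
next
  case False
  then show ?thesis
    using assms by (simp add: orthonormal_basis_def pairwise_def orthogonal_def)
qed

text \<open>Distinct basis vectors are at distance \<open>\<surd>2\<close>, so the balls of radius \<open>1/2\<close> around them are
  disjoint open sets, of which a second countable space has only countably many.\<close>

lemma countable_orthonormal_basis:
  fixes B :: "'a::{real_inner, second_countable_topology} set"
  assumes B: "orthonormal_basis B"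
  shows "countable B"
proof -
  have far: "1 < dist e f" if "e \<in> B" "f \<in> B" "e \<noteq> f" for e f
  proof -
    have "(dist e f)\<^sup>2 = 2"
      using that orthonormal_basis_inner[OF B]
      by (simp add: dist_norm power2_norm_eq_inner inner_diff_left inner_diff_right)
    then have "1\<^sup>2 < (dist e f)\<^sup>2" by simp
    then show ?thesis by (rule power2_less_imp_less) simp
  qed
  have disj: "disjnt (ball e (1/2)) (ball f (1/2))" if "e \<in> B" "f \<in> B" "e \<noteq> f" for e f
  proof -
    have False if x: "dist e x < 1/2" "dist f x < 1/2" for x
      using far[OF \<open>e \<in> B\<close> \<open>f \<in> B\<close> \<open>e \<noteq> f\<close>] dist_triangle[of e f x] x
      by (simp add: dist_commute)
    then show ?thesis by (auto simp: disjnt_def)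
  qed
  have inj: "inj_on (\<lambda>e. ball e (1/2)) B"
  proof (rule inj_onI, rule ccontr)
    fix e f assume "e \<in> B" "f \<in> B" "ball e (1/2) = ball f (1/2)" "e \<noteq> f"
    then have "disjnt (ball e (1/2)) (ball e (1/2))"
      using disj[of e f] by simp
    then show False by (simp add: disjnt_self_iff_empty)
  qed
  have "countable ((\<lambda>e. ball e (1/2)) ` B)"
  proof (rule countable_disjoint_open_subsets)
    show "disjoint ((\<lambda>e. ball e (1/2)) ` B)"
      using disj by (fastforce simp: pairwise_def disjnt_def)
  qed auto
  then show ?thesis
    using inj by (rule countable_image_inj_on)
qed

text \<open>The orthogonal projection onto the span of \<open>F\<close>, provided that \<open>F\<close> is finite and orthonormal.\<close>

definition proj :: "'a::real_inner set \<Rightarrow> 'a \<Rightarrow> 'a" where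
  "proj F x = (\<Sum>e\<in>F. (x \<bullet> e) *\<^sub>R e)"

lemma inner_residual_proj:
  assumes B: "orthonormal_basis B" and F: "finite F" "F \<subseteq> B" and y: "y \<in> span F"
  shows "(x - proj F x) \<bullet> y = 0"
  using y
proof (induction rule: span_induct_alt)
  case (step c e y)
  have "proj F x \<bullet> e = (\<Sum>f\<in>F. if f = e then x \<bullet> f else 0)"
    unfolding proj_def inner_sum_left
  proof (rule sum.cong)
    fix f assume "f \<in> F"
    then have "f \<bullet> e = (if f = e then 1 else 0)"
      using orthonormal_basis_inner[OF B, of f e] F step.hyps by blast
    then show "(x \<bullet> f) *\<^sub>R f \<bullet> e = (if f = e then x \<bullet> f else 0)" by simp
  qed simp
  then have "proj F x \<bullet> e = x \<bullet> e"
    using F step.hyps by simp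
  then show ?case
    using step.IH by (simp add: inner_diff_left inner_add_right)
qed simp

lemma proj_in_span: "proj F x \<in> span F"
  unfolding proj_def by (intro span_sum span_scale span_base)

text \<open>Best approximation: the residual is orthogonal to \<open>proj F x - y\<close>, so Pythagoras applies.\<close>

lemma norm_residual_proj_le:
  assumes B: "orthonormal_basis B" and F: "finite F" "F \<subseteq> B" and y: "y \<in> span F"
  shows "norm (x - proj F x) \<le> norm (x - y)"
proof -
  let ?r = "x - proj F x" and ?d = "proj F x - y"
  have "?r \<bullet> ?d = 0"
    using B F by (rule inner_residual_proj) (intro span_diff proj_in_span y)
  then have "(norm (?r + ?d))\<^sup>2 = (norm ?r)\<^sup>2 + (norm ?d)\<^sup>2"
    by (intro norm_add_Pythagorean) (simp add: orthogonal_def)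
  then have "(norm ?r)\<^sup>2 \<le> (norm (x - y))\<^sup>2" by simp
  then show ?thesis by (rule power2_le_imp_le) simp
qed

lemma norm_proj_le:
  assumes B: "orthonormal_basis B" and F: "finite F" "F \<subseteq> B"
  shows "norm (proj F x) \<le> norm x"
proof -
  have "(x - proj F x) \<bullet> proj F x = 0"
    using B F by (rule inner_residual_proj) (rule proj_in_span)
  then have "(norm (x - proj F x + proj F x))\<^sup>2 = (norm (x - proj F x))\<^sup>2 + (norm (proj F x))\<^sup>2"
    by (intro norm_add_Pythagorean) (simp add: orthogonal_def)
  then have "(norm (proj F x))\<^sup>2 \<le> (norm x)\<^sup>2" by simp
  then show ?thesis by (rule power2_le_imp_le) simp
qed

text \<open>Density of the span gives a finite combination \<open>y\<close> close to \<open>x\<close>. The projection onto any finite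
  \<open>F\<close> that contains the vectors occurring in \<open>y\<close> is at least as close to \<open>x\<close>.\<close>

lemma has_sum_orthonormal_expansion:
  assumes B: "orthonormal_basis B"
  shows "((\<lambda>e. (x \<bullet> e) *\<^sub>R e) has_sum x) B"
  unfolding has_sum_def
proof (rule tendstoI)
  fix \<epsilon> :: real assume "0 < \<epsilon>"
  have "x \<in> closure (span B)"
    using B by (simp add: orthonormal_basis_def)
  then obtain y where y: "y \<in> span B" "dist y x < \<epsilon>"
    using \<open>0 < \<epsilon>\<close> unfolding closure_approachable by blast
  from y(1) obtain F0 u where F0: "finite F0" "F0 \<subseteq> B" "y = (\<Sum>a\<in>F0. u a *\<^sub>R a)"
    unfolding span_explicit by blast
  show "\<forall>\<^sub>F F in finite_subsets_at_top B. dist (\<Sum>e\<in>F. (x \<bullet> e) *\<^sub>R e) x < \<epsilon>"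
    unfolding eventually_finite_subsets_at_top
  proof (intro exI[of _ F0] conjI allI impI F0(1,2))
    fix F assume F: "finite F \<and> F0 \<subseteq> F \<and> F \<subseteq> B"
    have "y \<in> span F"
      unfolding F0(3) using F by (intro span_sum span_scale span_base) auto
    then have "norm (x - proj F x) \<le> norm (x - y)"
      using norm_residual_proj_le[OF B] F by blast
    then show "dist (\<Sum>e\<in>F. (x \<bullet> e) *\<^sub>R e) x < \<epsilon>"
      using y(2) by (simp add: proj_def dist_norm norm_minus_commute)
  qed
qed

lemma has_sum_inner_parseval:
  assumes B: "orthonormal_basis B"
  shows "((\<lambda>e. (x \<bullet> e) * (e \<bullet> y)) has_sum (x \<bullet> y)) B"
  using has_sum_bounded_linear[OF bounded_linear_inner_left has_sum_orthonormal_expansion[OF B], of x y]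
  by (simp add: o_def)

section \<open>Unordered sums over countable sets\<close>

lemma countable_finite_exhaustion:
  assumes "countable B"
  obtains E :: "nat \<Rightarrow> 'a set" where "\<And>n. finite (E n)" "\<And>n. E n \<subseteq> B"
    "filterlim E (finite_subsets_at_top B) sequentially"
proof -
  let ?E = "\<lambda>n. {x\<in>B. to_nat_on B x < n}"
  have fin: "finite (?E n)" for n
  proof -
    have "inj_on (to_nat_on B) (?E n)"
      using inj_on_to_nat_on[OF assms] by (rule inj_on_subset) auto
    moreover have "finite (to_nat_on B ` ?E n)"
      by (rule finite_subset[of _ "{..<n}"]) auto
    ultimately show ?thesis by (rule finite_imageD[rotated])
  qed
  have "filterlim ?E (finite_subsets_at_top B) sequentially"
  proof (rule filterlim_finite_subsets_at_top[THEN iffD2], intro allI impI)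
    fix X assume X: "finite X \<and> X \<subseteq> B"
    let ?N = "Suc (Max (to_nat_on B ` X))"
    have "to_nat_on B x < n" if "x \<in> X" "?N \<le> n" for x n
    proof -
      have "to_nat_on B x \<le> Max (to_nat_on B ` X)"
        using X that by (intro Max_ge) auto
      with that show ?thesis by linarith
    qed
    then have "\<forall>n\<ge>?N. finite (?E n) \<and> X \<subseteq> ?E n \<and> ?E n \<subseteq> B"
      using X fin by blast
    then show "\<forall>\<^sub>F n in sequentially. finite (?E n) \<and> X \<subseteq> ?E n \<and> ?E n \<subseteq> B"
      unfolding eventually_sequentially by blast
  qed
  with fin show thesis by (intro that[of ?E]) auto
qed

text \<open>The dominated convergence theorem is about sequences, unordered sums are limits along a filter.
  Over a countable set the filter of finite subsets has a countable base, so it suffices to test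
  sequences of finite sets that converge along it.\<close>

lemma tendsto_finite_subsets_sequentiallyI:
  fixes h :: "'a set \<Rightarrow> 'b::metric_space"
  assumes "countable B"
    and seq: "\<And>F. \<lbrakk>\<And>n. finite (F n); \<And>n. F n \<subseteq> B; filterlim F (finite_subsets_at_top B) sequentially\<rbrakk>
      \<Longrightarrow> (\<lambda>n. h (F n)) \<longlonglongrightarrow> l"
  shows "(h \<longlongrightarrow> l) (finite_subsets_at_top B)"
proof (rule ccontr)
  assume "\<not> (h \<longlongrightarrow> l) (finite_subsets_at_top B)"
  then obtain \<epsilon> where \<epsilon>: "0 < \<epsilon>"
      and not_ev: "\<not> (\<forall>\<^sub>F F in finite_subsets_at_top B. dist (h F) l < \<epsilon>)"
    unfolding tendsto_iff by auto
  \<comment> \<open>Arbitrarily large finite sets violate the bound; choosing them above an exhaustion of \<open>B\<close>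
    gives a convergent sequence that violates it at every index.\<close>
  have bad: "\<exists>F. finite F \<and> X \<subseteq> F \<and> F \<subseteq> B \<and> \<not> dist (h F) l < \<epsilon>" if "finite X" "X \<subseteq> B" for X
  proof (rule ccontr)
    assume "\<not> ?thesis"
    then have "\<forall>\<^sub>F F in finite_subsets_at_top B. dist (h F) l < \<epsilon>"
      unfolding eventually_finite_subsets_at_top using that by auto
    with not_ev show False ..
  qed
  obtain E where E: "\<And>n. finite (E n)" "\<And>n. E n \<subseteq> B"
      "filterlim E (finite_subsets_at_top B) sequentially"
    using countable_finite_exhaustion[OF \<open>countable B\<close>] by blast
  have "\<forall>n. \<exists>F. finite F \<and> E n \<subseteq> F \<and> F \<subseteq> B \<and> \<not> dist (h F) l < \<epsilon>"
    by (intro allI bad E(1,2))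
  from choice[OF this] obtain F where F: "\<And>n. finite (F n)" "\<And>n. E n \<subseteq> F n" "\<And>n. F n \<subseteq> B"
      "\<And>n. \<not> dist (h (F n)) l < \<epsilon>"
    by blast
  have "filterlim F (finite_subsets_at_top B) sequentially"
    unfolding filterlim_finite_subsets_at_top
  proof (intro allI impI)
    fix X assume "finite X \<and> X \<subseteq> B"
    then have "\<forall>\<^sub>F n in sequentially. finite (E n) \<and> X \<subseteq> E n \<and> E n \<subseteq> B"
      using E(3) unfolding filterlim_finite_subsets_at_top by blast
    then show "\<forall>\<^sub>F n in sequentially. finite (F n) \<and> X \<subseteq> F n \<and> F n \<subseteq> B"
      by (rule eventually_mono) (use F(1,3) subset_trans[OF _ F(2)] in simp)
  qed
  then have "(\<lambda>n. h (F n)) \<longlonglongrightarrow> l"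
    by (rule seq[OF F(1,3)])
  then have "\<forall>\<^sub>F n in sequentially. dist (h (F n)) l < \<epsilon>"
    using \<epsilon> by (rule tendstoD)
  then show False
    using F(4) by simp
qed

section \<open>Positive square roots\<close>

lemma positive_form_cauchy_schwarz:
  assumes "positive_selfadjoint P"
  shows "(P x \<bullet> y)\<^sup>2 \<le> (P x \<bullet> x) * (P y \<bullet> y)"
proof -
  interpret P: bounded_linear P using assms by (simp add: positive_selfadjoint_def)
  define a b c where "a = P x \<bullet> x" and "b = P x \<bullet> y" and "c = P y \<bullet> y"
  have sym: "P y \<bullet> x = b"
    using assms by (simp add: positive_selfadjoint_def selfadjoint_def b_def inner_commute)
  have pos: "0 \<le> P z \<bullet> z" for z
    using assms by (simp add: positive_selfadjoint_def)
  have form: "0 \<le> s * s * a - 2 * s * t * b + t * t * c" for s t :: real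
    using pos[of "s *\<^sub>R x - t *\<^sub>R y"] sym
    by (simp add: P.diff P.scaleR inner_diff_left inner_diff_right a_def b_def c_def algebra_simps)
  have "0 \<le> a" "0 \<le> c" using pos by (simp_all add: a_def c_def)
  \<comment> \<open>If \<open>a\<close> or \<open>c\<close> is positive, the form at \<open>c x - b y\<close> or \<open>b x - a y\<close> gives the claim;
    if both vanish, the form at \<open>x - b y\<close> is \<open>- 2 b\<^sup>2\<close>, so \<open>b = 0\<close>.\<close>
  have "0 \<le> c * (a * c - b\<^sup>2)" "0 \<le> a * (a * c - b\<^sup>2)"
    using form[of c b] form[of b a] by (simp_all add: algebra_simps power2_eq_square)
  moreover have "b = 0" if "a = 0" "c = 0"
    using form[of 1 b] that by (auto simp: mult_le_0_iff)
  ultimately have "b\<^sup>2 \<le> a * c"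
    using \<open>0 \<le> a\<close> \<open>0 \<le> c\<close>
    by (cases "a = 0"; cases "c = 0") (auto simp: zero_le_mult_iff mult_le_0_iff)
  then show ?thesis by (simp add: a_def b_def c_def)
qed

text \<open>Cauchy-Schwarz for the form of \<open>P\<close>, applied to \<open>x\<close> and \<open>P x\<close>. So \<open>\<langle>P x, x\<rangle> \<rightarrow> 0\<close> forces
  \<open>P x \<rightarrow> 0\<close>.\<close>

lemma norm_le_positive_form:
  assumes P: "positive_selfadjoint P"
  shows "(norm (P x))\<^sup>2 \<le> onorm P * (P x \<bullet> x)"
proof (cases "P x = 0")
  case False
  have bl: "bounded_linear P" using P by (simp add: positive_selfadjoint_def)
  have pos: "0 \<le> P x \<bullet> x" using P by (simp add: positive_selfadjoint_def)
  have "P (P x) \<bullet> P x \<le> norm (P (P x)) * norm (P x)" by (rule norm_cauchy_schwarz)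
  also have "\<dots> \<le> onorm P * norm (P x) * norm (P x)"
    by (intro mult_right_mono onorm bl) simp
  finally have "(P x \<bullet> x) * (P (P x) \<bullet> P x) \<le> (P x \<bullet> x) * (onorm P * (norm (P x))\<^sup>2)"
    by (intro mult_left_mono pos) (simp add: power2_eq_square)
  with positive_form_cauchy_schwarz[OF P, of x "P x"]
  have "(norm (P x))\<^sup>2 * (norm (P x))\<^sup>2 \<le> onorm P * (P x \<bullet> x) * (norm (P x))\<^sup>2"
    by (simp add: power2_norm_eq_inner[symmetric] power2_eq_square algebra_simps)
  then show ?thesis
    by (rule mult_right_le_imp_le) (use False in simp)
qed simp

text \<open>The difference \<open>D = P - C\<close> satisfies \<open>P D = - D C\<close> and \<open>C D = - D P\<close>, because \<open>P\<^sup>2 = C\<^sup>2\<close>. Hence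
  \<open>P D\<^sup>2 = - D C D\<close> and \<open>C D\<^sup>2 = - D P D\<close> have nonpositive forms. On unit vectors \<open>x\<close> with
  \<open>\<parallel>D x\<parallel>\<close> close to \<open>\<kappa> = \<parallel>D\<parallel>\<close>, the selfadjoint operator \<open>D\<^sup>2\<close> acts almost as
  \<open>\<kappa>\<^sup>2\<close>, so \<open>\<kappa>\<^sup>2 \<langle>P x, x\<rangle>\<close> is at most a small error, and likewise for \<open>C\<close>. As
  both forms are nonnegative, \<open>P x\<close> and \<open>C x\<close> are small, hence so is \<open>D x\<close>, which forces \<open>\<kappa> = 0\<close>. This avoids constructing a square root
  by functional calculus.\<close>

lemma positive_square_root_unique:
  assumes P: "positive_selfadjoint P" and C: "positive_selfadjoint C"
    and eq: "P \<circ> P = C \<circ> C"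
  shows "P = C"
proof -
  interpret P: bounded_linear P using P by (simp add: positive_selfadjoint_def)
  interpret C: bounded_linear C using C by (simp add: positive_selfadjoint_def)
  have eq': "P (P x) = C (C x)" for x using eq by (simp add: fun_eq_iff)
  define D where "D = (\<lambda>x. P x - C x)"
  have D: "bounded_linear D"
    unfolding D_def by (intro bounded_linear_sub P.bounded_linear C.bounded_linear)
  interpret D: bounded_linear D by (rule D)
  have selfP: "P x \<bullet> y = x \<bullet> P y" and selfC: "C x \<bullet> y = x \<bullet> C y" for x y
    using P C by (simp_all add: positive_selfadjoint_def selfadjoint_def)
  have selfD: "D x \<bullet> y = x \<bullet> D y" for x y
    by (simp add: D_def inner_diff_left inner_diff_right selfP selfC)
  have PD: "P (D x) = - D (C x)" and CD: "C (D x) = - D (P x)" for x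
    by (simp_all add: D_def P.diff C.diff eq')
  define \<kappa> where "\<kappa> = onorm D"
  have "0 \<le> \<kappa>" unfolding \<kappa>_def by (rule onorm_pos_le[OF D])
  have small: "\<kappa>\<^sup>2 * (norm (T x))\<^sup>2 \<le> (onorm T)\<^sup>2 * norm (\<kappa>\<^sup>2 *\<^sub>R x - D (D x))"
    if T: "positive_selfadjoint T" and neg: "T (D (D x)) \<bullet> x \<le> 0" and x: "norm x = 1" for T x
  proof -
    interpret T: bounded_linear T using T by (simp add: positive_selfadjoint_def)
    let ?r = "\<kappa>\<^sup>2 *\<^sub>R x - D (D x)"
    have "\<kappa>\<^sup>2 * (T x \<bullet> x) \<le> T ?r \<bullet> x"
      using neg by (simp add: T.diff T.scaleR inner_diff_left)
    also have "\<dots> \<le> norm (T ?r) * norm x" by (rule norm_cauchy_schwarz)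
    also have "\<dots> \<le> onorm T * norm ?r"
      using onorm[OF T.bounded_linear, of ?r] x by simp
    finally have *: "\<kappa>\<^sup>2 * (T x \<bullet> x) \<le> onorm T * norm ?r" .
    have "\<kappa>\<^sup>2 * (norm (T x))\<^sup>2 \<le> \<kappa>\<^sup>2 * (onorm T * (T x \<bullet> x))"
      by (intro mult_left_mono norm_le_positive_form T) simp
    also have "\<dots> = onorm T * (\<kappa>\<^sup>2 * (T x \<bullet> x))" by simp
    also have "\<dots> \<le> onorm T * (onorm T * norm ?r)"
      by (intro mult_left_mono * onorm_pos_le T.bounded_linear)
    finally show ?thesis by (simp add: power2_eq_square)
  qed
  have "\<kappa> = 0"
  proof (rule ccontr)
    assume "\<kappa> \<noteq> 0"
    then have "0 < \<kappa>" using \<open>0 \<le> \<kappa>\<close> by simp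
    have "\<exists>x. norm x = 1 \<and> \<kappa> - inverse (real (Suc n)) \<le> norm (D x)" for n
    proof (rule ccontr)
      let ?c = "\<kappa> - inverse (real (Suc n))"
      assume "\<not> (\<exists>x. norm x = 1 \<and> ?c \<le> norm (D x))"
      then have lt: "norm (D x) < ?c" if "norm x = 1" for x using that by force
      obtain z where z: "D z \<noteq> 0"
        using \<open>0 < \<kappa>\<close> onorm_pos_lt[OF D] unfolding \<kappa>_def by blast
      have "z \<noteq> 0" using z D.zero by auto
      then have "0 \<le> ?c"
        using le_less_trans[OF norm_ge_zero lt[of "z /\<^sub>R norm z"]] by simp
      have "norm (D x) \<le> ?c * norm x" for x
      proof (cases "x = 0")
        case False
        then show ?thesis
          using lt[of "x /\<^sub>R norm x"] by (simp add: D.scaleR field_simps)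
      qed (simp add: D.zero)
      then have "\<kappa> \<le> ?c"
        using onorm_bound[OF \<open>0 \<le> ?c\<close>, of D] by (simp add: \<kappa>_def)
      then show False by simp
    qed
    then obtain x where x: "\<And>n. norm (x n) = 1" "\<And>n. \<kappa> - inverse (real (Suc n)) \<le> norm (D (x n))"
      by metis
    have Dx: "(\<lambda>n. norm (D (x n))) \<longlonglongrightarrow> \<kappa>"
    proof (rule tendsto_sandwich)
      show "\<forall>\<^sub>F n in sequentially. \<kappa> - inverse (real (Suc n)) \<le> norm (D (x n))"
        using x(2) by (intro always_eventually allI)
      show "\<forall>\<^sub>F n in sequentially. norm (D (x n)) \<le> \<kappa>"
        using onorm[OF D, of "x _"] x(1) by (intro always_eventually allI) (simp add: \<kappa>_def)
      show "(\<lambda>n. \<kappa> - inverse (real (Suc n))) \<longlonglongrightarrow> \<kappa>"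
        using tendsto_diff[OF tendsto_const LIMSEQ_inverse_real_of_nat, of \<kappa>] by simp
    qed simp
    let ?r = "\<lambda>n. \<kappa>\<^sup>2 *\<^sub>R x n - D (D (x n))"
    \<comment> \<open>Expand the square and use \<open>\<langle>x, D\<^sup>2 x\<rangle> = \<parallel>D x\<parallel>\<^sup>2\<close>: almost maximising vectors are almost
      eigenvectors of \<open>D\<^sup>2\<close>.\<close>
    have r_le: "(norm (?r n))\<^sup>2 \<le> 2 * \<kappa>^4 - 2 * \<kappa>\<^sup>2 * (norm (D (x n)))\<^sup>2" for n
    proof -
      have "norm (D (D (x n))) \<le> \<kappa> * norm (D (x n))"
        unfolding \<kappa>_def by (rule onorm[OF D])
      also have "\<dots> \<le> \<kappa> * (\<kappa> * norm (x n))"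
        unfolding \<kappa>_def by (intro mult_left_mono onorm[OF D] onorm_pos_le[OF D])
      finally have "(norm (D (D (x n))))\<^sup>2 \<le> (\<kappa>\<^sup>2)\<^sup>2"
        using x(1) by (intro power_mono) (simp_all add: power2_eq_square)
      moreover have "x n \<bullet> D (D (x n)) = (norm (D (x n)))\<^sup>2"
        by (simp add: selfD[symmetric] power2_norm_eq_inner)
      moreover have "x n \<bullet> x n = 1"
        using x(1)[of n] by (simp add: power2_norm_eq_inner[symmetric])
      ultimately show ?thesis
        unfolding power2_norm_eq_inner[of "?r n"] power2_norm_eq_inner[of "D (D (x n))"]
        by (simp add: inner_diff_left inner_diff_right inner_commute[of "D (D (x n))" "x n"]
            power4_eq_xxxx power2_eq_square right_diff_distrib mult.assoc)
    qed
    have "(\<lambda>n. 2 * \<kappa>^4 - 2 * \<kappa>\<^sup>2 * (norm (D (x n)))\<^sup>2) \<longlonglongrightarrow> 2 * \<kappa>^4 - 2 * \<kappa>\<^sup>2 * \<kappa>\<^sup>2"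
      by (intro tendsto_intros Dx)
    then have "(\<lambda>n. 2 * \<kappa>^4 - 2 * \<kappa>\<^sup>2 * (norm (D (x n)))\<^sup>2) \<longlonglongrightarrow> 0"
      by (simp add: power4_eq_xxxx power2_eq_square)
    then have "(\<lambda>n. (norm (?r n))\<^sup>2) \<longlonglongrightarrow> 0"
      by (rule tendsto_sandwich[OF _ _ tendsto_const, rotated 2]) (intro always_eventually allI r_le zero_le_power2)+
    then have r0: "(\<lambda>n. norm (?r n)) \<longlonglongrightarrow> 0"
      by (rule power_tendsto_0_iff[THEN iffD1, rotated]) simp
    have T0: "(\<lambda>n. norm (T (x n))) \<longlonglongrightarrow> 0"
      if T: "positive_selfadjoint T" and neg: "\<And>n. T (D (D (x n))) \<bullet> x n \<le> 0" for T
    proof -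
      have "(\<lambda>n. (onorm T)\<^sup>2 * norm (?r n) / \<kappa>\<^sup>2) \<longlonglongrightarrow> 0"
        using tendsto_divide[OF tendsto_mult[OF tendsto_const r0, of "(onorm T)\<^sup>2"] tendsto_const, of "\<kappa>\<^sup>2"]
          \<open>0 < \<kappa>\<close> by simp
      then have "(\<lambda>n. (norm (T (x n)))\<^sup>2) \<longlonglongrightarrow> 0"
      proof (rule tendsto_sandwich[OF _ _ tendsto_const, rotated 2])
        show "\<forall>\<^sub>F n in sequentially. (norm (T (x n)))\<^sup>2 \<le> (onorm T)\<^sup>2 * norm (?r n) / \<kappa>\<^sup>2"
          using small[OF T neg x(1)] \<open>0 < \<kappa>\<close>
          by (intro always_eventually allI) (simp add: pos_le_divide_eq mult.commute)
      qed simp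
      then show ?thesis
        by (rule power_tendsto_0_iff[THEN iffD1, rotated]) simp
    qed
    have negP: "P (D (D y)) \<bullet> y \<le> 0" for y
    proof -
      have "P (D (D y)) \<bullet> y = - (C (D y) \<bullet> D y)" by (simp add: PD selfD)
      then show ?thesis using C by (simp add: positive_selfadjoint_def)
    qed
    have negC: "C (D (D y)) \<bullet> y \<le> 0" for y
    proof -
      have "C (D (D y)) \<bullet> y = - (P (D y) \<bullet> D y)" by (simp add: CD selfD)
      then show ?thesis using P by (simp add: positive_selfadjoint_def)
    qed
    have "(\<lambda>n. norm (P (x n)) + norm (C (x n))) \<longlonglongrightarrow> 0"
      using tendsto_add[OF T0[OF P negP] T0[OF C negC]] by simp
    then have "(\<lambda>n. norm (D (x n))) \<longlonglongrightarrow> 0"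
    proof (rule tendsto_sandwich[OF _ _ tendsto_const, rotated 2])
      show "\<forall>\<^sub>F n in sequentially. norm (D (x n)) \<le> norm (P (x n)) + norm (C (x n))"
        unfolding D_def by (intro always_eventually allI norm_triangle_ineq4)
    qed simp
    with Dx have "\<kappa> = 0" by (rule LIMSEQ_unique)
    with \<open>\<kappa> \<noteq> 0\<close> show False ..
  qed
  then have "D x = 0" for x
    using onorm_eq_0[OF D] unfolding \<kappa>_def by blast
  then show ?thesis by (simp add: D_def fun_eq_iff)
qed

section \<open>Moments of Gaussian measures\<close>

lemma gaussian_real_central_moments:
  assumes "gaussian_real \<nu>"
  defines "m \<equiv> \<integral>x. x \<partial>\<nu>"
  shows integrable_gaussian_real_power: "integrable \<nu> (\<lambda>x. (x - m) ^ k)"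
    and "(\<integral>x. (x - m) ^ 3 \<partial>\<nu>) = 0"
    and "(\<integral>x. (x - m) ^ 4 \<partial>\<nu>) = 3 * (\<integral>x. (x - m)\<^sup>2 \<partial>\<nu>)\<^sup>2"
proof -
  have "integrable \<nu> (\<lambda>x. (x - m) ^ k) \<and> (\<integral>x. (x - m) ^ 3 \<partial>\<nu>) = 0 \<and>
      (\<integral>x. (x - m) ^ 4 \<partial>\<nu>) = 3 * (\<integral>x. (x - m)\<^sup>2 \<partial>\<nu>)\<^sup>2"
    using assms(1) unfolding gaussian_real_def
  proof (elim disjE exE conjE)
    fix a assume \<nu>: "\<nu> = return borel a"
    have m: "m = a" unfolding m_def \<nu> by (subst integral_return) auto
    have "integrable \<nu> (\<lambda>x. (x - m) ^ k)"
    proof (rule integrableI_bounded)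
      show "(\<integral>\<^sup>+x. norm ((x - m) ^ k) \<partial>\<nu>) < \<infinity>"
        unfolding \<nu> by (subst nn_integral_return) auto
    qed (simp add: \<nu>)
    moreover have "(\<integral>x. (x - m) ^ n \<partial>\<nu>) = (a - m) ^ n" for n
      unfolding \<nu> by (subst integral_return) auto
    ultimately show ?thesis by (simp add: m)
  next
    fix a \<sigma> :: real assume \<sigma>: "\<sigma> > 0" and \<nu>: "\<nu> = density lborel (\<lambda>x. ennreal (normal_density a \<sigma> x))"
    have m: "m = a"
      unfolding m_def \<nu> using integral_normal_moment_nz_1[OF \<sigma>, of a] by (simp add: integral_density)
    have "integrable \<nu> (\<lambda>x. (x - m) ^ k)"
      unfolding \<nu> m using integrable_normal_moment[OF \<sigma>, of a k] by (simp add: integrable_density)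
    moreover have "(\<integral>x. (x - m) ^ n \<partial>\<nu>) = (\<integral>x. normal_density a \<sigma> x * (x - a) ^ n \<partial>lborel)" for n
      unfolding \<nu> m by (simp add: integral_density)
    ultimately show ?thesis
      using integral_normal_moment_even[OF \<sigma>, of a 1] integral_normal_moment_even[OF \<sigma>, of a 2]
        integral_normal_moment_odd[OF \<sigma>, of a 1] \<sigma>
      by (simp add: fact_numeral power_divide flip: power_mult)
  qed
  then show "integrable \<nu> (\<lambda>x. (x - m) ^ k)" "(\<integral>x. (x - m) ^ 3 \<partial>\<nu>) = 0"
    "(\<integral>x. (x - m) ^ 4 \<partial>\<nu>) = 3 * (\<integral>x. (x - m)\<^sup>2 \<partial>\<nu>)\<^sup>2" by simp_all
qed

locale gaussian_hilbert =
  fixes m0 :: "'a::{real_inner, polish_space}" and C :: "'a \<Rightarrow> 'a" and \<mu> :: "'a measure"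
  assumes is_N: "is_N m0 C \<mu>"
begin

sublocale prob_space \<mu>
  using is_N by (simp add: is_N_def gaussian_measure_def)

abbreviation X :: "'a \<Rightarrow> 'a" where "X s \<equiv> s - m0"

lemma positive_C: "positive_selfadjoint C"
  using is_N by (simp add: is_N_def)

lemma bounded_linear_C: "bounded_linear C"
  using positive_C by (simp add: positive_selfadjoint_def)

lemma C_selfadjoint: "C u \<bullet> v = u \<bullet> C v"
  using positive_C by (simp add: positive_selfadjoint_def selfadjoint_def)

lemma C_nonneg: "0 \<le> C u \<bullet> u"
  using positive_C by (simp add: positive_selfadjoint_def)

lemma borel_measurable_continuous_gaussian:
  fixes f :: "'a \<Rightarrow> 'b::topological_space"
  assumes "continuous_on UNIV f"
  shows "f \<in> borel_measurable \<mu>"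
proof -
  have sets: "sets \<mu> = sets borel"
    using is_N by (simp add: is_N_def gaussian_measure_def)
  show ?thesis
    using borel_measurable_continuous_onI[OF assms] by (simp add: measurable_cong_sets[OF sets refl])
qed

lemma coordinate_moments:
  shows integrable_coordinate_power: "integrable \<mu> (\<lambda>s. (v \<bullet> X s) ^ k)"
    and "expectation (\<lambda>s. (v \<bullet> X s) ^ 3) = 0"
    and "expectation (\<lambda>s. (v \<bullet> X s) ^ 4) = 3 * (C v \<bullet> v)\<^sup>2"
proof -
  let ?f = "\<lambda>s. s \<bullet> v" and ?\<nu> = "distr \<mu> borel (\<lambda>s. s \<bullet> v)"
  have f [measurable]: "?f \<in> borel_measurable \<mu>"
    by (intro borel_measurable_continuous_gaussian continuous_intros)
  have g: "gaussian_real ?\<nu>"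
    using is_N bounded_linear_inner_left[of v] by (simp add: is_N_def gaussian_measure_def)
  have m: "(\<integral>x. x \<partial>?\<nu>) = m0 \<bullet> v"
    using is_N by (simp add: integral_distr is_N_def)
  have eq: "s \<bullet> v - m0 \<bullet> v = v \<bullet> X s" for s
    by (simp add: inner_diff_left inner_diff_right inner_commute)
  have int: "(\<integral>x. (x - m0 \<bullet> v) ^ n \<partial>?\<nu>) = expectation (\<lambda>s. (v \<bullet> X s) ^ n)" for n
    by (simp add: integral_distr eq)
  show "integrable \<mu> (\<lambda>s. (v \<bullet> X s) ^ k)"
    using integrable_gaussian_real_power[OF g, of k] unfolding m by (simp add: integrable_distr_eq eq)
  show "expectation (\<lambda>s. (v \<bullet> X s) ^ 3) = 0"
    using gaussian_real_central_moments(2)[OF g] unfolding m int .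
  have "expectation (\<lambda>s. (v \<bullet> X s)\<^sup>2) = C v \<bullet> v"
    using is_N by (simp add: is_N_def power2_eq_square)
  then show "expectation (\<lambda>s. (v \<bullet> X s) ^ 4) = 3 * (C v \<bullet> v)\<^sup>2"
    using gaussian_real_central_moments(3)[OF g] unfolding m int by simp
qed

text \<open>Polarisation: the alternating sum of \<open>(a \<plusminus> b \<plusminus> c)\<^sup>3\<close> over the signs is \<open>24 a b c\<close>.\<close>

lemma isserlis_third:
  "has_bochner_integral \<mu> (\<lambda>s. (a \<bullet> X s) * (b \<bullet> X s) * (c \<bullet> X s)) 0"
proof -
  have hb: "has_bochner_integral \<mu> (\<lambda>s. (v \<bullet> X s) ^ 3) 0" for v
    using coordinate_moments(2)[of v] integrable_coordinate_power[of v 3]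
    by (simp add: has_bochner_integral_iff)
  let ?T = "\<lambda>v s. (v \<bullet> X s) ^ 3"
  have "has_bochner_integral \<mu>
      (\<lambda>s. (?T (a + b + c) s - ?T (a + b - c) s - ?T (a - b + c) s + ?T (a - b - c) s) / 24)
      ((0 - 0 - 0 + 0) / 24)"
    by (intro has_bochner_integral_divide_zero has_bochner_integral_add has_bochner_integral_diff hb)
  moreover have "(?T (a + b + c) s - ?T (a + b - c) s - ?T (a - b + c) s + ?T (a - b - c) s) / 24
      = (a \<bullet> X s) * (b \<bullet> X s) * (c \<bullet> X s)" for s
    unfolding inner_add_left inner_diff_left by (simp add: field_simps power3_eq_cube)
  ultimately show ?thesis by simp
qed

text \<open>Polarisation again: the alternating sum of the eight powers \<open>(a \<plusminus> b \<plusminus> c \<plusminus> d)\<^sup>4\<close> is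
  \<open>192 a b c d\<close>. Each power has expectation \<open>3 \<langle>C v, v\<rangle>\<^sup>2\<close>, where \<open>v\<close> is the corresponding
  combination, and the same sum of these numbers yields the three pairings. Only one-dimensional
  marginals enter.\<close>

lemma isserlis_fourth:
  "has_bochner_integral \<mu> (\<lambda>s. (a \<bullet> X s) * (b \<bullet> X s) * (c \<bullet> X s) * (d \<bullet> X s))
    ((C a \<bullet> b) * (C c \<bullet> d) + (C a \<bullet> c) * (C b \<bullet> d) + (C a \<bullet> d) * (C b \<bullet> c))"
proof -
  interpret C: bounded_linear C by (rule bounded_linear_C)
  have hb: "has_bochner_integral \<mu> (\<lambda>s. (v \<bullet> X s) ^ 4) (3 * (C v \<bullet> v)\<^sup>2)" for v
    using coordinate_moments(3)[of v] integrable_coordinate_power[of v 4]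
    by (simp add: has_bochner_integral_iff)
  let ?T = "\<lambda>v s. (v \<bullet> X s) ^ 4" and ?q = "\<lambda>v. 3 * (C v \<bullet> v)\<^sup>2"
  have "has_bochner_integral \<mu>
      (\<lambda>s. (?T (a + b + c + d) s - ?T (a + b + c - d) s - ?T (a + b - c + d) s + ?T (a + b - c - d) s
        - ?T (a - b + c + d) s + ?T (a - b + c - d) s + ?T (a - b - c + d) s - ?T (a - b - c - d) s) / 192)
      ((?q (a + b + c + d) - ?q (a + b + c - d) - ?q (a + b - c + d) + ?q (a + b - c - d)
        - ?q (a - b + c + d) + ?q (a - b + c - d) + ?q (a - b - c + d) - ?q (a - b - c - d)) / 192)"
    by (intro has_bochner_integral_divide_zero has_bochner_integral_add has_bochner_integral_diff hb)
  moreover have "(?T (a + b + c + d) s - ?T (a + b + c - d) s - ?T (a + b - c + d) s + ?T (a + b - c - d) s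
        - ?T (a - b + c + d) s + ?T (a - b + c - d) s + ?T (a - b - c + d) s - ?T (a - b - c - d) s) / 192
      = (a \<bullet> X s) * (b \<bullet> X s) * (c \<bullet> X s) * (d \<bullet> X s)" for s
    unfolding inner_add_left inner_diff_left by (simp add: field_simps power4_eq_xxxx)
  moreover have "(?q (a + b + c + d) - ?q (a + b + c - d) - ?q (a + b - c + d) + ?q (a + b - c - d)
        - ?q (a - b + c + d) + ?q (a - b + c - d) + ?q (a - b - c + d) - ?q (a - b - c - d)) / 192
      = (C a \<bullet> b) * (C c \<bullet> d) + (C a \<bullet> c) * (C b \<bullet> d) + (C a \<bullet> d) * (C b \<bullet> c)"
  proof -
    have comm: "C u \<bullet> v = C v \<bullet> u" for u v
      by (metis C_selfadjoint inner_commute)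
    have sym: "C b \<bullet> a = C a \<bullet> b" "C c \<bullet> a = C a \<bullet> c" "C d \<bullet> a = C a \<bullet> d"
      "C c \<bullet> b = C b \<bullet> c" "C d \<bullet> b = C b \<bullet> d" "C d \<bullet> c = C c \<bullet> d"
      by (rule comm)+
    show ?thesis
      unfolding C.add C.diff inner_add_left inner_diff_left inner_add_right inner_diff_right sym
      by (simp add: field_simps power2_eq_square)
  qed
  ultimately show ?thesis by simp
qed

text \<open>The operator \<open>P\<close> in the trace-class condition satisfies \<open>P\<^sup>2 = C\<^sup>2\<close>, hence is \<open>C\<close>.\<close>

lemma trace_C_bounded:
  obtains B K where "orthonormal_basis B" "\<And>F. finite F \<Longrightarrow> F \<subseteq> B \<Longrightarrow> (\<Sum>e\<in>F. C e \<bullet> e) \<le> K"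
proof -
  have "trace_class C" using is_N by (simp add: is_N_def)
  then obtain P B where P: "positive_selfadjoint P" "P \<circ> P = adjoint C \<circ> C"
      and B: "orthonormal_basis B" and sum: "(\<lambda>e. P e \<bullet> e) summable_on B"
    unfolding trace_class_def by blast
  have "adjoint C = C"
    by (rule adjoint_unique) (simp add: C_selfadjoint)
  with P have "P = C"
    using positive_square_root_unique[OF P(1) positive_C] by simp
  with sum have "(\<lambda>e. C e \<bullet> e) summable_on B" by simp
  then have "(\<Sum>e\<in>F. C e \<bullet> e) \<le> (\<Sum>\<^sub>\<infinity>e\<in>B. C e \<bullet> e)" if "finite F" "F \<subseteq> B" for F
    using that by (intro finite_sum_le_infsum C_nonneg)
  with B show thesis by (rule that)
qed

text \<open>In a basis where the trace is finite, \<open>\<parallel>X\<parallel>\<^sup>4\<close> is the limit of squares of finite sums of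
  \<open>\<langle>e, X\<rangle>\<^sup>2\<close>. By Wick and Cauchy-Schwarz for \<open>C\<close> these have expectation at most \<open>3 (tr C)\<^sup>2\<close>, so
  Fatou applies.\<close>

lemma integrable_norm_power4: "integrable \<mu> (\<lambda>s. norm (X s) ^ 4)"
proof -
  obtain B K where B: "orthonormal_basis B"
      and K: "\<And>F. finite F \<Longrightarrow> F \<subseteq> B \<Longrightarrow> (\<Sum>e\<in>F. C e \<bullet> e) \<le> K"
    by (rule trace_C_bounded) blast
  obtain E where E: "\<And>n. finite (E n)" "\<And>n. E n \<subseteq> B"
      and Elim: "filterlim E (finite_subsets_at_top B) sequentially"
    by (rule countable_finite_exhaustion[OF countable_orthonormal_basis[OF B]]) blast
  define u where "u n s = (\<Sum>e\<in>E n. (e \<bullet> X s)\<^sup>2)\<^sup>2" for n s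
  have u_lim: "(\<lambda>n. u n s) \<longlonglongrightarrow> norm (X s) ^ 4" for s
  proof -
    have "(sum (\<lambda>e. (X s \<bullet> e) * (e \<bullet> X s)) \<longlongrightarrow> X s \<bullet> X s) (finite_subsets_at_top B)"
      using has_sum_inner_parseval[OF B] unfolding has_sum_def .
    from tendsto_power[OF filterlim_compose[OF this Elim], of 2]
    show ?thesis
      by (simp add: u_def inner_commute power2_norm_eq_inner[symmetric] flip: power2_eq_square power_mult)
  qed
  have meas [measurable]: "u n \<in> borel_measurable \<mu>" for n
    unfolding u_def by (intro borel_measurable_continuous_gaussian continuous_intros)
  have int_u: "has_bochner_integral \<mu> (u n)
      (\<Sum>e\<in>E n. \<Sum>f\<in>E n. (C e \<bullet> e) * (C f \<bullet> f) + 2 * (C e \<bullet> f)\<^sup>2)" for n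
  proof -
    have "has_bochner_integral \<mu>
        (\<lambda>s. \<Sum>e\<in>E n. \<Sum>f\<in>E n. (e \<bullet> X s) * (e \<bullet> X s) * (f \<bullet> X s) * (f \<bullet> X s))
        (\<Sum>e\<in>E n. \<Sum>f\<in>E n. (C e \<bullet> e) * (C f \<bullet> f) + (C e \<bullet> f) * (C e \<bullet> f) + (C e \<bullet> f) * (C e \<bullet> f))"
      by (intro has_bochner_integral_sum isserlis_fourth)
    then show ?thesis
      by (simp add: u_def[abs_def] power2_eq_square sum_product mult.assoc add.assoc)
  qed
  have "expectation (u n) \<le> 3 * K\<^sup>2" for n
  proof -
    have "expectation (u n) = (\<Sum>e\<in>E n. \<Sum>f\<in>E n. (C e \<bullet> e) * (C f \<bullet> f) + 2 * (C e \<bullet> f)\<^sup>2)"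
      using int_u by (rule has_bochner_integral_integral_eq)
    also have "\<dots> \<le> (\<Sum>e\<in>E n. \<Sum>f\<in>E n. 3 * ((C e \<bullet> e) * (C f \<bullet> f)))"
      using positive_form_cauchy_schwarz[OF positive_C] by (intro sum_mono) simp
    also have "\<dots> = 3 * (\<Sum>e\<in>E n. C e \<bullet> e)\<^sup>2"
      by (simp only: power2_eq_square sum_product) (simp only: sum_distrib_left)
    also have "\<dots> \<le> 3 * K\<^sup>2"
      using K[OF E] by (intro mult_left_mono power_mono sum_nonneg C_nonneg) auto
    finally show ?thesis .
  qed
  then have nn: "(\<integral>\<^sup>+s. ennreal (u n s) \<partial>\<mu>) \<le> ennreal (3 * K\<^sup>2)" for n
  proof -
    have "(\<integral>\<^sup>+s. ennreal (u n s) \<partial>\<mu>) = ennreal (expectation (u n))"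
      using int_u[of n] by (intro nn_integral_eq_integral) (simp add: has_bochner_integral_iff, simp add: u_def)
    then show ?thesis
      using \<open>\<And>n. expectation (u n) \<le> 3 * K\<^sup>2\<close>[of n] by (simp add: ennreal_leI del: ennreal_le_iff)
  qed
  have "(\<integral>\<^sup>+s. ennreal (norm (X s) ^ 4) \<partial>\<mu>) = (\<integral>\<^sup>+s. liminf (\<lambda>n. ennreal (u n s)) \<partial>\<mu>)"
    using lim_imp_Liminf[OF _ tendsto_ennrealI[OF u_lim]] by simp
  also have "\<dots> \<le> liminf (\<lambda>n. \<integral>\<^sup>+s. ennreal (u n s) \<partial>\<mu>)"
    by (intro nn_integral_liminf) simp
  also have "\<dots> \<le> liminf (\<lambda>n. ennreal (3 * K\<^sup>2))"
    by (intro Liminf_mono always_eventually allI nn)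
  also have "\<dots> < \<infinity>" by (simp add: Liminf_const)
  finally show ?thesis
    by (intro integrableI_bounded borel_measurable_continuous_gaussian continuous_intros) simp
qed

lemma integrable_norm_power2: "integrable \<mu> (\<lambda>s. (norm (X s))\<^sup>2)"
proof (rule Bochner_Integration.integrable_bound)
  show "integrable \<mu> (\<lambda>s. 1 + norm (X s) ^ 4)"
    by (intro Bochner_Integration.integrable_add integrable_norm_power4) simp
  have "x\<^sup>2 \<le> 1 + x ^ 4" for x :: real
  proof -
    have "0 \<le> (x\<^sup>2 - 1)\<^sup>2 + x\<^sup>2" by simp
    then show ?thesis by (simp add: power2_diff flip: power_mult)
  qed
  then show "AE s in \<mu>. norm ((norm (X s))\<^sup>2) \<le> norm (1 + norm (X s) ^ 4)"
    by simp
qed (intro borel_measurable_continuous_gaussian continuous_intros)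

text \<open>The partial sum over \<open>F\<close> is \<open>\<langle>T (proj F X), X\<rangle> G\<close>, which converges pointwise and is bounded by
  \<open>\<parallel>T\<parallel> \<parallel>X\<parallel>\<^sup>2 \<bar>G\<bar>\<close> for all \<open>F\<close> at once. The sum is unordered and over an arbitrary basis
  because the trace is defined by such sums.\<close>

lemma has_sum_expectation_form:
  assumes B: "orthonormal_basis B" and T: "bounded_linear T"
    and G [measurable]: "G \<in> borel_measurable \<mu>"
    and int: "integrable \<mu> (\<lambda>s. (norm (X s))\<^sup>2 * \<bar>G s\<bar>)"
  shows "((\<lambda>e. expectation (\<lambda>s. (e \<bullet> X s) * (T e \<bullet> X s) * G s)) has_sum
      expectation (\<lambda>s. (T (X s) \<bullet> X s) * G s)) B"
  unfolding has_sum_def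
proof (rule tendsto_finite_subsets_sequentiallyI[OF countable_orthonormal_basis[OF B]])
  interpret T: bounded_linear T by (rule T)
  have contT: "continuous_on S T" for S
    by (rule linear_continuous_on[OF T])
  fix F assume F: "\<And>n. finite (F n)" "\<And>n. F n \<subseteq> B"
    and Flim: "filterlim F (finite_subsets_at_top B) sequentially"
  define w where "w s = onorm T * ((norm (X s))\<^sup>2 * \<bar>G s\<bar>)" for s
  have w: "integrable \<mu> w" unfolding w_def using int by simp
  have bound: "norm ((T y \<bullet> X s) * G s) \<le> w s" if "norm y \<le> norm (X s)" for y s
  proof -
    have "\<bar>T y \<bullet> X s\<bar> \<le> norm (T y) * norm (X s)" by (rule Cauchy_Schwarz_ineq2)
    also have "\<dots> \<le> (onorm T * norm (X s)) * norm (X s)"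
      using order_trans[OF onorm[OF T] mult_left_mono[OF that onorm_pos_le[OF T]]]
      by (rule mult_right_mono) simp
    finally have "\<bar>T y \<bullet> X s\<bar> * \<bar>G s\<bar> \<le> (onorm T * norm (X s)) * norm (X s) * \<bar>G s\<bar>"
      by (rule mult_right_mono) simp
    then show ?thesis by (simp add: w_def abs_mult power2_eq_square mult.assoc)
  qed
  have projsum: "(\<Sum>e\<in>A. (e \<bullet> X s) * (T e \<bullet> X s) * G s) = (T (proj A (X s)) \<bullet> X s) * G s" for A s
    by (simp add: proj_def T.sum T.scaleR inner_sum_left sum_distrib_right inner_commute[of "X s"])
  have meas: "(\<lambda>s. (T (proj A (X s)) \<bullet> X s) * G s) \<in> borel_measurable \<mu>" for A
    unfolding proj_def
    by (intro borel_measurable_times G borel_measurable_continuous_gaussian continuous_intros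
        continuous_on_compose2[OF contT[of UNIV]]) auto
  have meas': "(\<lambda>s. (T (X s) \<bullet> X s) * G s) \<in> borel_measurable \<mu>"
    by (intro borel_measurable_times G borel_measurable_continuous_gaussian continuous_intros
        continuous_on_compose2[OF contT[of UNIV]]) auto
  have int_proj: "integrable \<mu> (\<lambda>s. (T (proj A (X s)) \<bullet> X s) * G s)" if "finite A" "A \<subseteq> B" for A
    using w meas
    by (rule Bochner_Integration.integrable_bound)
      (use order_trans[OF bound[OF norm_proj_le[OF B that]] abs_ge_self] in simp)
  have int1: "integrable \<mu> (\<lambda>s. (e \<bullet> X s) * (T e \<bullet> X s) * G s)" if "e \<in> B" for e
    using int_proj[of "{e}"] that unfolding projsum[symmetric] by simp
  have sum_eq: "(\<Sum>e\<in>F n. expectation (\<lambda>s. (e \<bullet> X s) * (T e \<bullet> X s) * G s)) =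
      expectation (\<lambda>s. (T (proj (F n) (X s)) \<bullet> X s) * G s)" for n
    using F(2)[of n] unfolding projsum[symmetric]
    by (intro Bochner_Integration.integral_sum[symmetric] int1) auto
  show "(\<lambda>n. \<Sum>e\<in>F n. expectation (\<lambda>s. (e \<bullet> X s) * (T e \<bullet> X s) * G s))
      \<longlonglongrightarrow> expectation (\<lambda>s. (T (X s) \<bullet> X s) * G s)"
    unfolding sum_eq
  proof (rule integral_dominated_convergence[OF meas' meas w])
    have "(\<lambda>n. (T (proj (F n) (X s)) \<bullet> X s) * G s) \<longlonglongrightarrow> (T (X s) \<bullet> X s) * G s" for s
    proof -
      have "(\<lambda>n. proj (F n) (X s)) \<longlonglongrightarrow> X s"
        using filterlim_compose[OF has_sum_orthonormal_expansion[OF B, unfolded has_sum_def] Flim]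
        by (simp add: proj_def)
      then show ?thesis by (intro tendsto_intros T.tendsto)
    qed
    then show "AE s in \<mu>. (\<lambda>n. (T (proj (F n) (X s)) \<bullet> X s) * G s) \<longlonglongrightarrow> (T (X s) \<bullet> X s) * G s"
      by simp
    show "AE s in \<mu>. norm ((T (proj (F n) (X s)) \<bullet> X s) * G s) \<le> w s" for n
      using bound[OF norm_proj_le[OF B F]] by simp
  qed
qed

section \<open>Quadratic forms under a Gaussian measure\<close>

text \<open>The case \<open>G = 1\<close>: the right-hand side does not mention the basis, so this is where the trace
  becomes basis independent.\<close>

lemma has_sum_trace_form:
  assumes B: "orthonormal_basis B" and T: "bounded_linear T"
  shows "((\<lambda>e. C e \<bullet> T e) has_sum expectation (\<lambda>s. T (X s) \<bullet> X s)) B"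
proof -
  have "((\<lambda>e. expectation (\<lambda>s. (e \<bullet> X s) * (T e \<bullet> X s) * 1)) has_sum
      expectation (\<lambda>s. (T (X s) \<bullet> X s) * 1)) B"
    using integrable_norm_power2 by (intro has_sum_expectation_form B T) simp_all
  moreover have "expectation (\<lambda>s. (e \<bullet> X s) * (T e \<bullet> X s)) = C e \<bullet> T e" for e
    using is_N by (simp add: is_N_def)
  ultimately show ?thesis by simp
qed

lemma borel_measurable_form:
  assumes T: "bounded_linear T"
  shows "(\<lambda>s. T (X s) \<bullet> X s) \<in> borel_measurable \<mu>"
  by (intro borel_measurable_continuous_gaussian continuous_intros
      continuous_on_compose2[OF linear_continuous_on[OF T, of UNIV]]) auto

lemma abs_form_le:
  assumes T: "bounded_linear T"
  shows "\<bar>T x \<bullet> x\<bar> \<le> onorm T * (norm x)\<^sup>2"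
proof -
  have "\<bar>T x \<bullet> x\<bar> \<le> norm (T x) * norm x" by (rule Cauchy_Schwarz_ineq2)
  also have "\<dots> \<le> onorm T * norm x * norm x"
    by (intro mult_right_mono onorm T) simp
  finally show ?thesis by (simp add: power2_eq_square mult.assoc)
qed

lemma integrable_norm_power2_bounded_form:
  assumes G: "G \<in> borel_measurable \<mu>" and bound: "\<And>s. \<bar>G s\<bar> \<le> c * (norm (X s))\<^sup>2"
  shows "integrable \<mu> (\<lambda>s. (norm (X s))\<^sup>2 * \<bar>G s\<bar>)"
proof (rule Bochner_Integration.integrable_bound)
  show "integrable \<mu> (\<lambda>s. c * norm (X s) ^ 4)"
    using integrable_norm_power4 by simp
  show "(\<lambda>s. (norm (X s))\<^sup>2 * \<bar>G s\<bar>) \<in> borel_measurable \<mu>"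
    by (intro borel_measurable_times borel_measurable_abs G)
      (intro borel_measurable_continuous_gaussian continuous_intros)
  have "(norm (X s))\<^sup>2 * \<bar>G s\<bar> \<le> c * norm (X s) ^ 4" for s
    using mult_left_mono[OF bound[of s], of "(norm (X s))\<^sup>2"]
    by (simp add: power4_eq_xxxx power2_eq_square mult_ac)
  then show "AE s in \<mu>. norm ((norm (X s))\<^sup>2 * \<bar>G s\<bar>) \<le> norm (c * norm (X s) ^ 4)"
    by (auto intro: order_trans[OF _ abs_ge_self])
qed

text \<open>Expand the form over a basis, apply Wick to each summand, and add up: the pairing
  \<open>\<langle>C e, A e\<rangle> \<langle>C u, v\<rangle>\<close> produces the expectation of the form, the two mixed pairings become
  Parseval sums for \<open>\<langle>C u, A C v\<rangle>\<close>.\<close>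

lemma expectation_linear_linear_form:
  assumes A: "bounded_linear A" and selfA: "selfadjoint A"
  shows "expectation (\<lambda>s. (u \<bullet> X s) * (v \<bullet> X s) * (A (X s) \<bullet> X s)) =
    (C u \<bullet> v) * expectation (\<lambda>s. A (X s) \<bullet> X s) + 2 * (A (C u) \<bullet> C v)"
proof -
  obtain B :: "'a set" where B: "orthonormal_basis B"
    using trace_C_bounded by blast
  have symA: "A x \<bullet> y = x \<bullet> A y" for x y
    using selfA by (simp add: selfadjoint_def)
  let ?G = "\<lambda>s. (u \<bullet> X s) * (v \<bullet> X s)"
  have G: "?G \<in> borel_measurable \<mu>"
    by (intro borel_measurable_continuous_gaussian continuous_intros)
  have "\<bar>?G s\<bar> \<le> (norm u * norm v) * (norm (X s))\<^sup>2" for s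
  proof -
    have "\<bar>u \<bullet> X s\<bar> * \<bar>v \<bullet> X s\<bar> \<le> (norm u * norm (X s)) * (norm v * norm (X s))"
      by (intro mult_mono Cauchy_Schwarz_ineq2) auto
    then show ?thesis by (simp add: abs_mult power2_eq_square mult_ac)
  qed
  then have "integrable \<mu> (\<lambda>s. (norm (X s))\<^sup>2 * \<bar>?G s\<bar>)"
    by (rule integrable_norm_power2_bounded_form[OF G])
  from has_sum_expectation_form[OF B A G this]
  have "((\<lambda>e. expectation (\<lambda>s. (e \<bullet> X s) * (A e \<bullet> X s) * ?G s)) has_sum
      expectation (\<lambda>s. (A (X s) \<bullet> X s) * ?G s)) B" .
  moreover have "expectation (\<lambda>s. (e \<bullet> X s) * (A e \<bullet> X s) * ?G s) =
      (C e \<bullet> A e) * (C u \<bullet> v) + (C u \<bullet> e) * (e \<bullet> A (C v)) + (C v \<bullet> e) * (e \<bullet> A (C u))" for e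
  proof -
    have "C (A e) \<bullet> w = e \<bullet> A (C w)" "C e \<bullet> w = C w \<bullet> e" for w
      by (simp_all add: C_selfadjoint symA inner_commute[of e])
    then show ?thesis
      using has_bochner_integral_integral_eq[OF isserlis_fourth[of e "A e" u v]]
      by (simp add: mult.assoc)
  qed
  moreover have "((\<lambda>e. (C e \<bullet> A e) * (C u \<bullet> v) + (C u \<bullet> e) * (e \<bullet> A (C v)) + (C v \<bullet> e) * (e \<bullet> A (C u)))
      has_sum expectation (\<lambda>s. A (X s) \<bullet> X s) * (C u \<bullet> v) + C u \<bullet> A (C v) + C v \<bullet> A (C u)) B"
    by (intro has_sum_add has_sum_cmult_left has_sum_trace_form has_sum_inner_parseval B A)
  ultimately have "expectation (\<lambda>s. (A (X s) \<bullet> X s) * ?G s) =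
      expectation (\<lambda>s. A (X s) \<bullet> X s) * (C u \<bullet> v) + C u \<bullet> A (C v) + C v \<bullet> A (C u)"
    by (simp add: has_sum_unique)
  moreover have "C u \<bullet> A (C v) = A (C u) \<bullet> C v" "C v \<bullet> A (C u) = A (C u) \<bullet> C v"
    by (simp_all add: symA inner_commute[of "C v"])
  ultimately show ?thesis by (simp add: mult_ac)
qed

lemma integrable_form:
  assumes A: "bounded_linear A"
  shows "integrable \<mu> (\<lambda>s. A (X s) \<bullet> X s)" "integrable \<mu> (\<lambda>s. (A (X s) \<bullet> X s)\<^sup>2)"
proof -
  show "integrable \<mu> (\<lambda>s. A (X s) \<bullet> X s)"
  proof (rule Bochner_Integration.integrable_bound)
    show "integrable \<mu> (\<lambda>s. onorm A * (norm (X s))\<^sup>2)"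
      using integrable_norm_power2 by simp
    show "AE s in \<mu>. norm (A (X s) \<bullet> X s) \<le> norm (onorm A * (norm (X s))\<^sup>2)"
      using abs_form_le[OF A] by (auto intro: order_trans[OF _ abs_ge_self])
  qed (rule borel_measurable_form[OF A])
  show "integrable \<mu> (\<lambda>s. (A (X s) \<bullet> X s)\<^sup>2)"
  proof (rule Bochner_Integration.integrable_bound)
    show "integrable \<mu> (\<lambda>s. (onorm A)\<^sup>2 * norm (X s) ^ 4)"
      using integrable_norm_power4 by simp
    have "(A (X s) \<bullet> X s)\<^sup>2 \<le> (onorm A)\<^sup>2 * norm (X s) ^ 4" for s
      using power_mono[OF abs_form_le[OF A, of "X s"], of 2] by (simp add: power_mult_distrib flip: power_mult)
    then show "AE s in \<mu>. norm ((A (X s) \<bullet> X s)\<^sup>2) \<le> norm ((onorm A)\<^sup>2 * norm (X s) ^ 4)"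
      by simp
  qed (intro borel_measurable_power borel_measurable_form A)
qed

lemma integrable_linear_times_form:
  assumes A: "bounded_linear A"
  shows "integrable \<mu> (\<lambda>s. (w \<bullet> X s) * (A (X s) \<bullet> X s))"
proof (rule Bochner_Integration.integrable_bound)
  show "integrable \<mu> (\<lambda>s. (w \<bullet> X s)\<^sup>2 + (A (X s) \<bullet> X s)\<^sup>2)"
    by (intro Bochner_Integration.integrable_add integrable_coordinate_power integrable_form A)
  have "\<bar>x * y\<bar> \<le> x\<^sup>2 + y\<^sup>2" for x y :: real
  proof -
    have "0 \<le> (\<bar>x\<bar> - \<bar>y\<bar>)\<^sup>2 + x\<^sup>2 + y\<^sup>2" by simp
    then show ?thesis by (simp add: power2_diff abs_mult)
  qed
  then show "AE s in \<mu>. norm ((w \<bullet> X s) * (A (X s) \<bullet> X s)) \<le> norm ((w \<bullet> X s)\<^sup>2 + (A (X s) \<bullet> X s)\<^sup>2)"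
    by simp
qed (intro borel_measurable_times borel_measurable_form A
      borel_measurable_continuous_gaussian continuous_intros)

text \<open>After expanding the form over a basis, every summand is a third moment.\<close>

lemma expectation_linear_times_form:
  assumes A: "bounded_linear A"
  shows "expectation (\<lambda>s. (w \<bullet> X s) * (A (X s) \<bullet> X s)) = 0"
proof -
  obtain B :: "'a set" where B: "orthonormal_basis B"
    using trace_C_bounded by blast
  have meas: "(\<lambda>s. w \<bullet> X s) \<in> borel_measurable \<mu>"
    by (intro borel_measurable_continuous_gaussian continuous_intros)
  have "integrable \<mu> (\<lambda>s. \<bar>(w \<bullet> X s) * (id (X s) \<bullet> X s)\<bar>)"
    by (intro integrable_abs integrable_linear_times_form) (simp add: id_def)
  then have "integrable \<mu> (\<lambda>s. (norm (X s))\<^sup>2 * \<bar>w \<bullet> X s\<bar>)"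
    by (simp add: abs_mult power2_norm_eq_inner mult.commute)
  from has_sum_expectation_form[OF B A meas this]
  have "((\<lambda>e. 0) has_sum expectation (\<lambda>s. (A (X s) \<bullet> X s) * (w \<bullet> X s))) B"
    by (simp only: has_bochner_integral_integral_eq[OF isserlis_third])
  then show ?thesis
    using has_sum_unique[OF _ has_sum_0[of B "\<lambda>_. 0"]] by (simp add: mult.commute)
qed

text \<open>Expand only one of the two factors over a basis. The expansion of the other one, in
  \<open>expectation_linear_linear_form\<close>, then leaves the sums of \<open>\<langle>C e, A e\<rangle>\<close> and \<open>\<langle>C e, A C A e\<rangle>\<close>, which are
  expectations of forms.\<close>

lemma expectation_form_square:
  assumes A: "bounded_linear A" and selfA: "selfadjoint A"
  shows "expectation (\<lambda>s. (A (X s) \<bullet> X s)\<^sup>2) =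
    (expectation (\<lambda>s. A (X s) \<bullet> X s))\<^sup>2 + 2 * expectation (\<lambda>s. A (C (A (X s))) \<bullet> X s)"
proof -
  obtain B :: "'a set" where B: "orthonormal_basis B"
    using trace_C_bounded by blast
  let ?Q = "\<lambda>s. A (X s) \<bullet> X s"
  have ACA: "bounded_linear (\<lambda>x. A (C (A x)))"
    by (intro bounded_linear_compose[OF A] bounded_linear_compose[OF bounded_linear_C] A)
  have "integrable \<mu> (\<lambda>s. (norm (X s))\<^sup>2 * \<bar>?Q s\<bar>)"
    using abs_form_le[OF A] by (rule integrable_norm_power2_bounded_form[OF borel_measurable_form[OF A]])
  from has_sum_expectation_form[OF B A borel_measurable_form[OF A] this]
  have "((\<lambda>e. (C e \<bullet> A e) * expectation ?Q + 2 * (A (C e) \<bullet> C (A e))) has_sum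
      expectation (\<lambda>s. (?Q s)\<^sup>2)) B"
    by (simp only: expectation_linear_linear_form[OF A selfA] power2_eq_square)
  moreover have "A (C e) \<bullet> C (A e) = C e \<bullet> A (C (A e))" for e
    using selfA by (simp add: selfadjoint_def)
  moreover have "((\<lambda>e. (C e \<bullet> A e) * expectation ?Q + 2 * (C e \<bullet> A (C (A e)))) has_sum
      expectation ?Q * expectation ?Q + 2 * expectation (\<lambda>s. A (C (A (X s))) \<bullet> X s)) B"
    by (intro has_sum_add has_sum_cmult_left has_sum_cmult_right has_sum_trace_form[OF B] A ACA)
  ultimately show ?thesis
    by (simp add: has_sum_unique power2_eq_square)
qed

text \<open>The diagonal entries are \<open>\<langle>C e, A C A e\<rangle>\<close>, so the sum has the same value in every basis. Some
  basis exists, by the trace-class condition on \<open>C\<close>, so this value is the unique one.\<close>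

lemma op_trace_CA_square:
  assumes A: "bounded_linear A" and selfA: "selfadjoint A"
  shows "op_trace ((C \<circ> A) ^^ 2) = expectation (\<lambda>s. A (C (A (X s))) \<bullet> X s)"
proof -
  let ?t = "expectation (\<lambda>s. A (C (A (X s))) \<bullet> X s)"
  have ACA: "bounded_linear (\<lambda>x. A (C (A x)))"
    by (intro bounded_linear_compose[OF A] bounded_linear_compose[OF bounded_linear_C] A)
  have "((C \<circ> A) ^^ 2) e \<bullet> e = C e \<bullet> A (C (A e))" for e
    by (simp add: numeral_2_eq_2 C_selfadjoint inner_commute)
  then have sum: "((\<lambda>e. ((C \<circ> A) ^^ 2) e \<bullet> e) has_sum ?t) B" if "orthonormal_basis B" for B
    using has_sum_trace_form[OF that ACA] by simp
  obtain B0 :: "'a set" where B0: "orthonormal_basis B0"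
    using trace_C_bounded by blast
  show ?thesis
    unfolding op_trace_def
  proof (rule the_equality)
    show "\<forall>B. orthonormal_basis B \<longrightarrow> ((\<lambda>e. ((C \<circ> A) ^^ 2) e \<bullet> e) has_sum ?t) B"
      using sum by blast
    fix t assume "\<forall>B. orthonormal_basis B \<longrightarrow> ((\<lambda>e. ((C \<circ> A) ^^ 2) e \<bullet> e) has_sum t) B"
    then show "t = ?t"
      using B0 sum[OF B0] by (blast intro: has_sum_unique)
  qed
qed

end

section \<open>The variance of a quadratic functional\<close>

theorem theorem1:
  fixes A C :: "'a::{real_inner, polish_space} \<Rightarrow> 'a" and b m0 :: 'a and \<mu> :: "'a measure"
  assumes "bounded_linear A" and "selfadjoint A"
    and "is_N m0 C \<mu>"
  shows "integrable \<mu> (quadratic_functional A b) \<and>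
    integrable \<mu> (\<lambda>m. (quadratic_functional A b m)\<^sup>2) \<and>
    Var \<mu> (quadratic_functional A b) =
      (weighted_norm C (A m0 + b))\<^sup>2 + 1/2 * op_trace ((C \<circ> A) ^^ 2)"
proof -
  interpret gaussian_hilbert m0 C \<mu>
    using assms(3) by unfold_locales
  interpret A: bounded_linear A by (rule assms(1))
  let ?Z = "quadratic_functional A b"
  define w k where "w = A m0 + b" and "k = 1/2 * (A m0 \<bullet> m0) + b \<bullet> m0"
  define L Q where "L s = w \<bullet> X s" and "Q s = A (X s) \<bullet> X s" for s
  have Z: "?Z s = k + L s + 1/2 * Q s" for s
  proof -
    have "A s \<bullet> m0 = A m0 \<bullet> s"
      using assms(2) by (simp add: selfadjoint_def inner_commute)
    then show ?thesis
      by (simp add: quadratic_functional_def k_def L_def Q_def w_def A.diff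
          inner_diff_left inner_diff_right inner_add_left algebra_simps)
  qed
  have Z2: "(?Z s)\<^sup>2 = k\<^sup>2 + (L s)\<^sup>2 + 1/4 * (Q s)\<^sup>2 + 2 * k * L s + k * Q s + L s * Q s" for s
    unfolding Z by (simp add: power2_eq_square algebra_simps)
  have [simp]: "integrable \<mu> L" "integrable \<mu> (\<lambda>s. (L s)\<^sup>2)" "integrable \<mu> Q"
      "integrable \<mu> (\<lambda>s. (Q s)\<^sup>2)" "integrable \<mu> (\<lambda>s. L s * Q s)"
    using integrable_coordinate_power[of w 1] integrable_coordinate_power[of w 2]
      integrable_form[OF assms(1)] integrable_linear_times_form[OF assms(1)]
    by (simp_all add: L_def[abs_def] Q_def[abs_def])
  have EL: "expectation L = 0"
  proof -
    have "expectation (\<lambda>s. s \<bullet> w) = m0 \<bullet> w" using assms(3) by (simp add: is_N_def)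
    moreover have "integrable \<mu> (\<lambda>s. L s + m0 \<bullet> w)" by simp
    then have "expectation (\<lambda>s. L s + m0 \<bullet> w) = expectation L + m0 \<bullet> w" by (simp add: prob_space)
    moreover have "L s + m0 \<bullet> w = s \<bullet> w" for s by (simp add: L_def inner_diff_right inner_commute)
    ultimately show ?thesis by simp
  qed
  have EL2: "expectation (\<lambda>s. (L s)\<^sup>2) = C w \<bullet> w"
    using assms(3) by (simp add: is_N_def L_def power2_eq_square)
  have ELQ: "expectation (\<lambda>s. L s * Q s) = 0"
    unfolding L_def Q_def by (rule expectation_linear_times_form[OF assms(1)])
  have EQ2: "expectation (\<lambda>s. (Q s)\<^sup>2) = (expectation Q)\<^sup>2 + 2 * op_trace ((C \<circ> A) ^^ 2)"
    using expectation_form_square[OF assms(1,2)] op_trace_CA_square[OF assms(1,2)]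
    by (simp add: Q_def[abs_def])
  have "integrable \<mu> ?Z" "integrable \<mu> (\<lambda>s. (?Z s)\<^sup>2)"
    unfolding Z2 by (simp_all add: Z[abs_def])
  moreover have "expectation ?Z = k + 1/2 * expectation Q"
    by (simp add: Z[abs_def] EL prob_space)
  moreover have "expectation (\<lambda>s. (?Z s)\<^sup>2) =
      k\<^sup>2 + C w \<bullet> w + 1/4 * ((expectation Q)\<^sup>2 + 2 * op_trace ((C \<circ> A) ^^ 2)) + k * expectation Q"
    unfolding Z2 by (simp add: EL EL2 EQ2 ELQ prob_space)
  moreover have "(weighted_norm C w)\<^sup>2 = C w \<bullet> w"
    by (simp add: weighted_norm_def C_nonneg)
  ultimately show ?thesis
    unfolding Var_def w_def by (simp add: power2_eq_square algebra_simps)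
qed

end
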